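(* Let $m\in\mathbb N$, $m\ge1$, and let $T$ be an aperiodic Borel automorphism of a standard Borel space $(X,\mathcal B)$. Then for any $\varepsilon>0$ and any Borel probability measures $\mu_1,\dots,\mu_p$ on $X$ there exists a Borel subset $F\subset X$ such that $F,TF,\dots,T^{m-1}F$ are pairwise disjoint and $$\mu_i(F\cup TF\cup\cdots\cup T^{m-1}F)>1-\varepsilon,\qquad i=1,\dots,p.$$
   Context: A Borel automorphism $T$ of $X$ is aperiodic if every $T$-orbit is infinite, i.e. $T^nx\ne x$ for all $x\in X$ and all $n\ge 1$. *)

theory Defs
  imports "HOL-Probability.Probability"
begin

text \<open>A standard Borel space is a measurable space whose sigma-algebra is the Borel sigma-algebra
  of some Polish topology on the underlying set. The predicates below depend on \<open>M\<close> only through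
  \<open>space M\<close> and \<open>sets M\<close>; the values of \<open>emeasure M\<close> are irrelevant.\<close>

definition standard_borel_space :: "'a measure \<Rightarrow> bool" where
  "standard_borel_space M \<longleftrightarrow>
     (\<exists>X. completely_metrizable_space X \<and> separable_space X \<and> topspace X = space M \<and>
          sets M = sigma_sets (space M) {U. openin X U})"

definition borel_automorphism :: "'a measure \<Rightarrow> ('a \<Rightarrow> 'a) \<Rightarrow> bool" where
  "borel_automorphism M T \<longleftrightarrow>
     bij_betw T (space M) (space M) \<and>
     T \<in> M \<rightarrow>\<^sub>M M \<and> the_inv_into (space M) T \<in> M \<rightarrow>\<^sub>M M"

definition aperiodic :: "'a measure \<Rightarrow> ('a \<Rightarrow> 'a) \<Rightarrow> bool" where
  "aperiodic M T \<longleftrightarrow> (\<forall>x\<in>space M. \<forall>n\<ge>1. (T ^^ n) x \<noteq> x)"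

end

theory Submission
  imports Defs
begin

text \<open>A greedy construction along a countable cover gives a Borel marker set \<open>B\<close> whose
  return times are at least \<open>n = K m\<close> and which every orbit visits with bounded gaps, so that \<open>X\<close>
  decomposes into towers of heights \<open>L \<ge> n\<close> over \<open>B\<close>. In a tower of height \<open>L\<close>, blocks of length
  \<open>m\<close> are stacked upwards from level \<open>0\<close> to level \<open>s m\<close> and downwards from level \<open>L\<close>; fewer
  than \<open>m\<close> levels, starting at level \<open>s m\<close>, are left over. For distinct \<open>s < K\<close> the uncovered sets are
  disjoint, so if \<open>K > p / \<epsilon>\<close> one of them has \<open>\<mu>\<^sub>1 + \<dots> + \<mu>\<^sub>p\<close>-measure less than \<open>\<epsilon>\<close>.\<close>

section \<open>Countable bases of separable metrizable spaces\<close>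

text \<open>The balls of radius \<open>1 / Suc k\<close> about a countable dense set form a base:
  once the radius is below \<open>r / 2\<close>, such a ball containing \<open>x\<close> stays
  inside the \<open>r\<close>-ball about \<open>x\<close>.\<close>

lemma separable_metrizable_imp_second_countable:
  assumes "metrizable_space X" "separable_space X"
  shows "second_countable X"
proof -
  obtain S d where "Metric_space S d" and X: "X = Metric_space.mtopology S d"
    using assms(1) unfolding metrizable_space_def by blast
  then interpret Metric_space S d
    by simp
  obtain C where C: "countable C" "C \<subseteq> S" "mtopology closure_of C = S"
    using assms(2) unfolding separable_space_def X by auto
  define \<U> where "\<U> = (\<lambda>(c, k). mball c (1 / real (Suc k))) ` (C \<times> UNIV)"
  have "\<exists>V\<in>\<U>. x \<in> V \<and> V \<subseteq> U" if U: "openin mtopology U" "x \<in> U" for U x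
  proof -
    obtain r where r: "r > 0" "mball x r \<subseteq> U"
      using U unfolding openin_mtopology by blast
    have x: "x \<in> S"
      using U openin_mtopology by blast
    obtain k where k: "1 / real (Suc k) < r / 2"
      using r(1) reals_Archimedean[of "r / 2"] by (auto simp: inverse_eq_divide)
    have "x \<in> mtopology closure_of C"
      using x C(3) by simp
    then have "\<exists>c\<in>C. c \<in> mball x (1 / real (Suc k))"
      unfolding metric_closure_of by auto
    then obtain c where c: "c \<in> C" "c \<in> S" "d x c < 1 / real (Suc k)"
      by auto
    have "mball c (1 / real (Suc k)) \<subseteq> mball x r"
      using c k x by (intro mball_subset) (auto simp: commute)
    then show ?thesis
      using r c x by (intro bexI[of _ "mball c (1 / real (Suc k))"])
        (auto simp: \<U>_def commute intro!: image_eqI[of _ _ "(c, k)"])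
  qed
  moreover have "countable \<U>" "\<forall>V\<in>\<U>. openin mtopology V"
    using C(1) by (auto simp: \<U>_def)
  ultimately show ?thesis
    unfolding second_countable_def X by (intro exI[of _ \<U>]) blast
qed

section \<open>Packing blocks of length \<open>m\<close> into \<open>{..<L}\<close>\<close>

text \<open>Lowest levels of the blocks. For \<open>s * m \<le> L\<close> the levels left over are
  the first \<open>(L - s * m) mod m\<close> levels from \<open>s * m\<close> on, so
  \<open>s\<close> controls where the gap sits.\<close>

definition block_starts :: "nat \<Rightarrow> nat \<Rightarrow> nat \<Rightarrow> nat set" where
  "block_starts m s L = {a. (a < s * m \<and> m dvd a) \<or> (s * m \<le> a \<and> a < L \<and> m dvd (L - a))}"

text \<open>The distance from a start to the boundary above it is a positive multiple of
  \<open>m\<close>, hence at least \<open>m\<close>.\<close>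

lemma block_starts_end:
  assumes "a \<in> block_starts m s L" "s * m \<le> L"
  shows "a + m \<le> L" "a < s * m \<Longrightarrow> a + m \<le> s * m"
proof -
  have 1: "a + m \<le> s * m" if "a < s * m" "m dvd a"
  proof -
    have "m dvd s * m - a"
      using that by (intro dvd_diff_nat) auto
    then show ?thesis
      using that dvd_imp_le[of m "s * m - a"] by linarith
  qed
  moreover have "a + m \<le> L" if "a < L" "m dvd (L - a)"
    using that dvd_imp_le[of m "L - a"] by linarith
  ultimately show "a + m \<le> L" "a < s * m \<Longrightarrow> a + m \<le> s * m"
    using assms unfolding block_starts_def by auto
qed

lemma dvd_diff_small:
  fixes x y k l m :: nat
  assumes "x + k = y + l" "k < m" "l < m" "int m dvd int x - int y"
  shows "k = l"
proof -
  have "int x - int y = int l - int k"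
    using assms(1) by linarith
  then have "int m dvd int l - int k"
    using assms(4) by simp
  moreover have "\<bar>int l - int k\<bar> < int m"
    using assms(2,3) by linarith
  ultimately show ?thesis
    using dvd_imp_le_int[of "int l - int k" "int m"] by linarith
qed

text \<open>Starts on the same side of \<open>s * m\<close> are congruent modulo \<open>m\<close>;
  on different sides, the lower block ends before the upper one begins.\<close>

lemma block_starts_unique:
  assumes "a \<in> block_starts m s L" "a' \<in> block_starts m s L" "s * m \<le> L"
    and "a + k = a' + l" "k < m" "l < m"
  shows "k = l"
proof (cases "a < s * m \<longleftrightarrow> a' < s * m")
  case True
  have "int m dvd int a - int a'"
  proof (cases "a < s * m")
    case True
    then have "m dvd a" "m dvd a'"
      using assms(1,2) \<open>a < s * m \<longleftrightarrow> a' < s * m\<close> unfolding block_starts_def by auto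
    then show ?thesis
      by simp
  next
    case False
    then have *: "m dvd (L - a)" "m dvd (L - a')" "a < L" "a' < L"
      using assms(1,2) \<open>a < s * m \<longleftrightarrow> a' < s * m\<close> unfolding block_starts_def by auto
    \<comment> \<open>In the integers this difference equals \<open>a - a'\<close>.\<close>
    then have "int m dvd int (L - a') - int (L - a)"
      by (intro dvd_diff) (simp_all only: of_nat_dvd_iff)
    then show ?thesis
      using * by (simp add: of_nat_diff)
  qed
  then show ?thesis
    using assms by (intro dvd_diff_small[of a k a' l m])
next
  case False
  then show ?thesis
    using block_starts_end[OF assms(1,3)] block_starts_end[OF assms(2,3)] assms(4-6) by linarith
qed

lemma block_starts_cover:
  assumes "b < L" "m \<ge> 1" "\<not> (s * m \<le> b \<and> b < s * m + m)" "s * m \<le> L"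
  shows "\<exists>a\<in>block_starts m s L. \<exists>k<m. b = a + k"
proof (cases "b < s * m")
  case True
  \<comment> \<open>Below \<open>s * m\<close>, rounding down to a multiple of \<open>m\<close>
    gives the start.\<close>
  have "b - b mod m \<in> block_starts m s L"
    using True by (auto simp: block_starts_def)
  then show ?thesis
    using assms(2) by (intro bexI[of _ "b - b mod m"] exI[of _ "b mod m"]) auto
next
  case False
  \<comment> \<open>The ceiling of \<open>(L - b) / m\<close>, so that \<open>L - q * m\<close> is
    the last start counted from the top that does not exceed \<open>b\<close>. It exceeds
    \<open>b - m\<close>, hence lies above \<open>s * m\<close>.\<close>
  define q where "q = (L - b + (m - 1)) div m"
  have q: "L - b \<le> q * m" "q * m < L - b + m"
  proof -
    have "q * m + (L - b + (m - 1)) mod m = L - b + (m - 1)"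
      unfolding q_def by (rule div_mult_mod_eq)
    moreover have "(L - b + (m - 1)) mod m < m"
      using assms(2) by simp
    ultimately show "L - b \<le> q * m" "q * m < L - b + m"
      using assms(2) by linarith+
  qed
  have "s * m + m \<le> b"
    using False assms(3) by auto
  then have "L - q * m \<in> block_starts m s L"
    using q assms(1) by (auto simp: block_starts_def)
  moreover have "b = (L - q * m) + (b + q * m - L)" "b + q * m - L < m"
    using q assms(1) \<open>s * m + m \<le> b\<close> by linarith+
  ultimately show ?thesis
    by blast
qed

section \<open>Iterates of a Borel automorphism\<close>

locale borel_aut =
  fixes M :: "'a measure" and T :: "'a \<Rightarrow> 'a"
  assumes borel_aut: "borel_automorphism M T"
begin

lemma bij_funpow: "bij_betw (T ^^ k) (space M) (space M)"
  using borel_aut unfolding borel_automorphism_def by (intro bij_betw_funpow) auto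

lemma funpow_space: "x \<in> space M \<Longrightarrow> (T ^^ k) x \<in> space M"
  using bij_funpow[of k] by (auto simp: bij_betw_def)

lemma funpow_inj: "x \<in> space M \<Longrightarrow> y \<in> space M \<Longrightarrow> (T ^^ k) x = (T ^^ k) y \<Longrightarrow> x = y"
  using bij_funpow[of k] by (auto simp: bij_betw_def inj_on_def)

lemma funpow_plus: "(T ^^ i) ((T ^^ j) x) = (T ^^ (i + j)) x"
  by (simp add: funpow_add)

lemma funpow_cancel:
  assumes "x \<in> space M" "y \<in> space M" "(T ^^ i) x = (T ^^ j) y" "i \<le> j"
  shows "x = (T ^^ (j - i)) y"
proof (rule funpow_inj[of _ _ i])
  show "(T ^^ i) x = (T ^^ i) ((T ^^ (j - i)) y)"
    using assms by (simp add: funpow_plus)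
qed (use assms funpow_space in auto)

text \<open>The image of a set under \<open>T\<close> is its preimage under the measurable
  inverse.\<close>

lemma funpow_image_sets:
  assumes "A \<in> sets M"
  shows "(T ^^ k) ` A \<in> sets M"
proof (induction k)
  case (Suc k)
  have T: "bij_betw T (space M) (space M)" "the_inv_into (space M) T \<in> M \<rightarrow>\<^sub>M M"
    using borel_aut by (auto simp: borel_automorphism_def)
  let ?A = "(T ^^ k) ` A"
  have "?A \<subseteq> space M"
    using Suc by (rule sets.sets_into_space)
  then have "T ` ?A = the_inv_into (space M) T -` ?A \<inter> space M"
    using T(1) by (force simp: bij_betw_def the_inv_into_f_f f_the_inv_into_f
        intro: image_eqI[of _ T "the_inv_into (space M) T _"])
  moreover have "\<dots> \<in> sets M"
    using T(2) Suc by (rule measurable_sets)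
  ultimately show ?case
    by (simp add: image_comp)
qed (use assms in simp)

lemma funpow_vimage_sets:
  assumes "A \<in> sets M"
  shows "(T ^^ k) -` A \<inter> space M \<in> sets M"
proof -
  have "T ^^ k \<in> M \<rightarrow>\<^sub>M M"
    using borel_aut by (induction k) (auto simp: borel_automorphism_def)
  then show ?thesis
    using assms by (rule measurable_sets)
qed

section \<open>Borel marker sets\<close>

definition separated :: "nat \<Rightarrow> 'a set \<Rightarrow> bool" where
  "separated n A \<longleftrightarrow> (\<forall>x\<in>A. \<forall>j. 1 \<le> j \<and> j < n \<longrightarrow> (T ^^ j) x \<notin> A)"

text \<open>Neighbourhood along orbits in both time directions; images stand in for negative powers,
  as \<open>^^\<close> takes natural exponents.\<close>

definition nbhd :: "nat \<Rightarrow> 'a set \<Rightarrow> 'a set" where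
  "nbhd n A = (\<Union>j<n. ((T ^^ j) -` A \<inter> space M) \<union> (T ^^ j) ` A)"

lemma nbhd_sets: "A \<in> sets M \<Longrightarrow> nbhd n A \<in> sets M"
  unfolding nbhd_def using funpow_image_sets funpow_vimage_sets by auto

lemma nbhd_mono: "A \<subseteq> A' \<Longrightarrow> nbhd n A \<subseteq> nbhd n A'"
  unfolding nbhd_def by blast

text \<open>Since \<open>nbhd\<close> is two-sided, a new point neither enters \<open>C\<close> nor
  is reached from \<open>C\<close> in fewer than \<open>n\<close> steps.\<close>

lemma separated_extend:
  assumes "separated n C" "separated n A" "A \<subseteq> space M"
  shows "separated n (C \<union> (A - nbhd n C))"
  unfolding separated_def
proof (intro ballI allI impI)
  fix x j
  assume x: "x \<in> C \<union> (A - nbhd n C)" and j: "1 \<le> j \<and> j < n"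
  have "(T ^^ j) x \<in> nbhd n C" if "x \<in> C"
    using that j by (auto simp: nbhd_def)
  moreover have "x \<in> nbhd n C" if "(T ^^ j) x \<in> C" "x \<in> A"
    using that j assms(3) by (auto simp: nbhd_def)
  ultimately show "(T ^^ j) x \<notin> C \<union> (A - nbhd n C)"
    using x j assms(1,2) unfolding separated_def by blast
qed

text \<open>Greedy selection: a point of \<open>A i\<close> is rejected at stage \<open>i\<close>
  only if it is already near the points chosen, so the final set is near every point. Separation
  passes to the union because two points always lie in a common stage.\<close>

lemma marker_from_cover:
  fixes A :: "nat \<Rightarrow> 'a set"
  assumes A: "\<And>i. A i \<in> sets M" "\<And>i. separated n (A i)" and cover: "space M \<subseteq> (\<Union>i. A i)"
    and n: "n \<ge> 1"
  shows "\<exists>B\<in>sets M. separated n B \<and> space M \<subseteq> nbhd n B"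
proof -
  define C where "C = rec_nat {} (\<lambda>i D. D \<union> (A i - nbhd n D))"
  have C0: "C 0 = {}" and CS: "C (Suc i) = C i \<union> (A i - nbhd n (C i))" for i
    by (simp_all add: C_def)
  have C_sets: "C i \<in> sets M" for i
    by (induction i) (simp_all add: C0 CS A nbhd_sets sets.Un sets.Diff)
  have C_sep: "separated n (C i)" for i
  proof (induction i)
    case (Suc i)
    then show ?case
      unfolding CS using A sets.sets_into_space[OF A(1)] by (intro separated_extend)
  qed (simp add: C0 separated_def)
  have C_mono: "mono C"
    by (rule incseq_SucI) (auto simp: CS)
  have "separated n (\<Union>i. C i)"
    unfolding separated_def
  proof (intro ballI allI impI notI)
    fix x j
    assume "x \<in> (\<Union>i. C i)" "(T ^^ j) x \<in> (\<Union>i. C i)" and j: "1 \<le> j \<and> j < n"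
    then obtain i i' where "x \<in> C i" "(T ^^ j) x \<in> C i'"
      by blast
    then have "x \<in> C (max i i')" "(T ^^ j) x \<in> C (max i i')"
      using monoD[OF C_mono] by (meson max.cobounded1 max.cobounded2 subsetD)+
    then show False
      using C_sep j unfolding separated_def by blast
  qed
  moreover have "space M \<subseteq> nbhd n (\<Union>i. C i)"
  proof
    fix x assume x: "x \<in> space M"
    then obtain i where "x \<in> A i"
      using cover by blast
    moreover have "C (Suc i) \<subseteq> nbhd n (C (Suc i))"
    proof
      fix y assume "y \<in> C (Suc i)"
      then show "y \<in> nbhd n (C (Suc i))"
        using n unfolding nbhd_def by (intro UN_I[of 0]) auto
    qed
    ultimately have "x \<in> nbhd n (C (Suc i))"
      using nbhd_mono[of "C i" "C (Suc i)" n] by (auto simp: CS)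
    then show "x \<in> nbhd n (\<Union>i. C i)"
      using nbhd_mono[of "C (Suc i)" "\<Union>i. C i" n] by blast
  qed
  ultimately show ?thesis
    using C_sets by blast
qed

lemma marker_exists:
  assumes "standard_borel_space M" "aperiodic M T" "n \<ge> 1"
  shows "\<exists>B\<in>sets M. separated n B \<and> space M \<subseteq> nbhd n B"
proof -
  obtain X where X: "completely_metrizable_space X" "separable_space X" "topspace X = space M"
    "sets M = sigma_sets (space M) {U. openin X U}"
    using assms(1) unfolding standard_borel_space_def by blast
  have met: "metrizable_space X"
    using X(1) by (rule completely_metrizable_imp_metrizable_space)
  then have "second_countable X"
    using X(2) by (rule separable_metrizable_imp_second_countable)
  then obtain \<U> where \<U>: "countable \<U>" "\<And>V. V \<in> \<U> \<Longrightarrow> openin X V"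
    "\<And>U x. openin X U \<Longrightarrow> x \<in> U \<Longrightarrow> \<exists>V\<in>\<U>. x \<in> V \<and> V \<subseteq> U"
    unfolding second_countable_def by metis
  have openin_sets: "openin X U \<Longrightarrow> U \<in> sets M" for U
    unfolding X(4) by auto
  \<comment> \<open>Deleting the points that return to \<open>U\<close> too early makes any
    \<open>U\<close> separated.\<close>
  define A where "A U = U - (\<Union>j\<in>{1..<n}. (T ^^ j) -` U \<inter> space M)" for U
  \<comment> \<open>Inserting the empty set makes the family nonempty, as an enumeration by all
    naturals requires.\<close>
  define f where "f = from_nat_into (insert {} \<U>)"
  have f: "openin X (f i)" for i
    using from_nat_into[of "insert {} \<U>" i] \<U>(2) unfolding f_def by auto
  have rf: "range f = insert {} \<U>"
    unfolding f_def using \<U>(1) by (intro range_from_nat_into) auto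
  have "A (f i) \<in> sets M" for i
    unfolding A_def using openin_sets[OF f]
    by (intro sets.Diff sets.finite_UN funpow_vimage_sets) auto
  moreover have "separated n (A (f i))" for i
    unfolding separated_def A_def using openin_subset[OF f] X(3) by auto
  moreover have "space M \<subseteq> (\<Union>i. A (f i))"
  proof
    fix x assume x: "x \<in> space M"
    \<comment> \<open>By aperiodicity \<open>x\<close> is not in this finite, hence closed, set. A
      basic neighbourhood \<open>V\<close> of \<open>x\<close> avoiding it has \<open>x\<close> in
      \<open>A V\<close>.\<close>
    define S where "S = (\<lambda>j. (T ^^ j) x) ` {1..<n}"
    have "closedin X S"
    proof -
      have "t1_space X"
        using met by (simp add: metrizable_imp_t1_space)
      moreover have "S \<subseteq> topspace X" "finite S"
        using x funpow_space by (auto simp: S_def X(3))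
      ultimately show ?thesis
        using t1_space_closedin_finite by blast
    qed
    then have "openin X (topspace X - S)"
      by blast
    moreover have "x \<in> topspace X - S"
      using x assms(2) unfolding S_def aperiodic_def X(3) by force
    ultimately obtain V where V: "V \<in> \<U>" "x \<in> V" "V \<subseteq> topspace X - S"
      using \<U>(3) by blast
    then have "x \<in> A V"
      unfolding A_def S_def by auto
    moreover obtain i where "f i = V"
      using rf V(1) by (metis insertCI rangeE)
    ultimately show "x \<in> (\<Union>i. A (f i))"
      by blast
  qed
  ultimately show ?thesis
    using assms(3) by (intro marker_from_cover)
qed

section \<open>Towers over a marker set\<close>

text \<open>For \<open>L \<ge> 1\<close> these are the points of first return time \<open>L\<close>;
  for \<open>L = 0\<close> the formula gives \<open>B\<close>.\<close>

definition tower_base :: "'a set \<Rightarrow> nat \<Rightarrow> 'a set" where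
  "tower_base B L = {y \<in> B. (T ^^ L) y \<in> B \<and> (\<forall>j. 1 \<le> j \<and> j < L \<longrightarrow> (T ^^ j) y \<notin> B)}"

lemma tower_base_sets:
  assumes "B \<in> sets M"
  shows "tower_base B L \<in> sets M"
proof -
  have "tower_base B L =
      B \<inter> ((T ^^ L) -` B \<inter> space M) - (\<Union>j\<in>{1..<L}. (T ^^ j) -` B \<inter> space M)"
    using sets.sets_into_space[OF assms] unfolding tower_base_def by auto
  also have "\<dots> \<in> sets M"
    using assms by (intro sets.Diff sets.Int sets.finite_UN funpow_vimage_sets) auto
  finally show ?thesis .
qed

text \<open>Cancelling the smaller power puts one base point on the forward orbit of the other,
  before its first return. So the base points agree, and with them the return times.\<close>

lemma tower_level_unique:
  assumes B: "B \<subseteq> space M"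
    and y: "y \<in> tower_base B L" "a < L" and y': "y' \<in> tower_base B L'" "a' < L'"
    and eq: "(T ^^ a) y = (T ^^ a') y'"
  shows "a = a' \<and> L = L'"
proof -
  have le: "a = a' \<and> y = y'"
    if "y \<in> tower_base B L" "y' \<in> tower_base B L'" "a' < L'" "(T ^^ a) y = (T ^^ a') y'" "a \<le> a'"
    for y y' a a' L L'
  proof -
    have yB: "y \<in> B" "y' \<in> B"
      using that unfolding tower_base_def by auto
    then have "y = (T ^^ (a' - a)) y'"
      using that B by (intro funpow_cancel) auto
    moreover from this have "\<not> (1 \<le> a' - a \<and> a' - a < L')"
      using that(2) yB unfolding tower_base_def by auto
    ultimately show ?thesis
      using that(3,5) by auto
  qed
  have *: "a = a' \<and> y = y'"
    using le[OF y(1) y' eq] le[OF y'(1) y eq[symmetric]] by linarith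
  have "\<not> L < L'" "\<not> L' < L"
    using * y y' unfolding tower_base_def by auto
  then show ?thesis
    using * by auto
qed

text \<open>The tower through \<open>x\<close> is found by going back to the latest visit to
  \<open>B\<close> and then forward to the next return.\<close>

lemma tower_cover:
  assumes B: "B \<subseteq> space M" "separated n B" "space M \<subseteq> nbhd n B" and x: "x \<in> space M"
  shows "\<exists>L\<ge>n. \<exists>a<L. x \<in> (T ^^ a) ` tower_base B L"
proof -
  have past: "\<exists>a. \<exists>y\<in>B. x = (T ^^ a) y"
  proof -
    \<comment> \<open>\<open>nbhd\<close> does not tell on which side the nearby point of
      \<open>B\<close> lies. Starting \<open>n\<close> steps before \<open>x\<close> forces it into
      the past of \<open>x\<close>.\<close>
    obtain w where w: "w \<in> space M" "x = (T ^^ n) w"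
      using x bij_funpow[of n] by (auto simp: bij_betw_def)
    then obtain j where j: "j < n" "(T ^^ j) w \<in> B \<or> w \<in> (T ^^ j) ` B"
      using B(3) unfolding nbhd_def by blast
    then show ?thesis
    proof (elim disjE)
      assume "(T ^^ j) w \<in> B"
      moreover have "x = (T ^^ (n - j)) ((T ^^ j) w)"
        using w j by (simp add: funpow_plus)
      ultimately show ?thesis
        by blast
    next
      assume "w \<in> (T ^^ j) ` B"
      then obtain b where "b \<in> B" "x = (T ^^ (n + j)) b"
        using w by (auto simp: funpow_plus)
      then show ?thesis
        by blast
    qed
  qed
  have future: "\<exists>r\<ge>1. (T ^^ r) z \<in> B" if z: "z \<in> space M" for z
  proof -
    \<comment> \<open>The same shift, now forwards, puts the point of \<open>B\<close> strictly
      after \<open>z\<close>.\<close>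
    obtain j where j: "j < n" "(T ^^ j) ((T ^^ n) z) \<in> B \<or> (T ^^ n) z \<in> (T ^^ j) ` B"
      using funpow_space[OF z] B(3) unfolding nbhd_def by blast
    then show ?thesis
    proof (elim disjE)
      assume "(T ^^ j) ((T ^^ n) z) \<in> B"
      then show ?thesis
        using j by (intro exI[of _ "j + n"]) (auto simp: funpow_plus)
    next
      assume "(T ^^ n) z \<in> (T ^^ j) ` B"
      then obtain b where b: "b \<in> B" "(T ^^ j) b = (T ^^ n) z"
        by auto
      then have "b = (T ^^ (n - j)) z"
        using j z B(1) by (intro funpow_cancel) auto
      then show ?thesis
        using b j by (intro exI[of _ "n - j"]) auto
    qed
  qed
  define a where "a = (LEAST a. \<exists>y\<in>B. x = (T ^^ a) y)"
  have a_min: "a \<le> a'" if "y \<in> B" "x = (T ^^ a') y" for a' y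
    unfolding a_def using that by (intro Least_le) auto
  have "\<exists>y\<in>B. x = (T ^^ a) y"
    unfolding a_def using past by (rule LeastI_ex)
  then obtain y where y: "y \<in> B" "x = (T ^^ a) y"
    by blast
  define L where "L = (LEAST r. r \<ge> 1 \<and> (T ^^ r) y \<in> B)"
  have L: "L \<ge> 1 \<and> (T ^^ L) y \<in> B"
    unfolding L_def by (rule LeastI_ex) (use future y B(1) in auto)
  have L_min: "(T ^^ r) y \<notin> B" if "1 \<le> r \<and> r < L" for r
    using that not_less_Least[of r "\<lambda>r. r \<ge> 1 \<and> (T ^^ r) y \<in> B"] unfolding L_def by auto
  have "y \<in> tower_base B L"
    using y L L_min unfolding tower_base_def by auto
  moreover have "L \<ge> n"
    using B(2) y(1) L unfolding separated_def by (meson not_le)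
  moreover have "a < L"
  proof (rule ccontr)
    \<comment> \<open>Otherwise \<open>(T ^^ L) y\<close> would be a visit to \<open>B\<close>
      closer to \<open>x\<close>, against the minimality of \<open>a\<close>.\<close>
    assume "\<not> a < L"
    then have "x = (T ^^ (a - L)) ((T ^^ L) y)"
      using y by (simp add: funpow_plus)
    then have "a \<le> a - L"
      using L a_min by blast
    then show False
      using L \<open>\<not> a < L\<close> by linarith
  qed
  ultimately show ?thesis
    using y by blast
qed

section \<open>Bottom levels of the blocks in all towers\<close>

definition tower_set :: "'a set \<Rightarrow> nat \<Rightarrow> nat \<Rightarrow> nat \<Rightarrow> 'a set" where
  "tower_set B n m s = (\<Union>L\<in>{n..}. \<Union>a\<in>block_starts m s L. (T ^^ a) ` tower_base B L)"

lemma tower_set_sets: "B \<in> sets M \<Longrightarrow> tower_set B n m s \<in> sets M"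
  unfolding tower_set_def
  by (intro sets.countable_UN'' funpow_image_sets tower_base_sets) auto

text \<open>A common point determines its tower height and level, and blocks in one tower do not
  overlap.\<close>

lemma tower_set_disjoint:
  assumes "B \<subseteq> space M" "s * m \<le> n"
  shows "disjoint_family_on (\<lambda>k. (T ^^ k) ` tower_set B n m s) {..<m}"
proof -
  have "k = l"
    if kl: "k < m" "l < m" and z: "z \<in> (T ^^ k) ` tower_set B n m s" "z \<in> (T ^^ l) ` tower_set B n m s"
    for k l z
  proof -
    obtain L a y where 1: "n \<le> L" "a \<in> block_starts m s L" "y \<in> tower_base B L" "z = (T ^^ (k + a)) y"
      using z(1) by (auto simp: tower_set_def funpow_plus)
    obtain L' a' y' where 2: "n \<le> L'" "a' \<in> block_starts m s L'" "y' \<in> tower_base B L'"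
      "z = (T ^^ (l + a')) y'"
      using z(2) by (auto simp: tower_set_def funpow_plus)
    have "k + a < L" "l + a' < L'"
      using block_starts_end(1)[OF 1(2)] block_starts_end(1)[OF 2(2)] 1(1) 2(1) assms(2) kl by linarith+
    then have "k + a = l + a'" "L = L'"
      using tower_level_unique[OF assms(1) 1(3) _ 2(3), of "k + a" "l + a'"] 1(4) 2(4) by auto
    then show ?thesis
      using block_starts_unique[OF 1(2), of a' k l] 1 2 kl assms(2) by auto
  qed
  then show ?thesis
    unfolding disjoint_family_on_def by blast
qed

text \<open>The gap of every tower, whatever its height, lies in the same \<open>m\<close> levels.
  The exceptional set can therefore be written with images of \<open>B\<close> alone.\<close>

lemma tower_set_cover:
  assumes "B \<subseteq> space M" "separated n B" "space M \<subseteq> nbhd n B" "m \<ge> 1" "s * m \<le> n"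
  shows "space M - (\<Union>j\<in>{s * m..<s * m + m}. (T ^^ j) ` B) \<subseteq> (\<Union>k<m. (T ^^ k) ` tower_set B n m s)"
proof
  fix x assume x: "x \<in> space M - (\<Union>j\<in>{s * m..<s * m + m}. (T ^^ j) ` B)"
  then obtain L b y where L: "n \<le> L" "b < L" "y \<in> tower_base B L" "x = (T ^^ b) y"
    using tower_cover[OF assms(1-3), of x] by auto
  then have "\<not> (s * m \<le> b \<and> b < s * m + m)"
    using x by (auto simp: tower_base_def)
  then obtain a k where a: "a \<in> block_starts m s L" "k < m" "b = a + k"
    using block_starts_cover[OF L(2) assms(4)] L(1) assms(5) by (meson le_trans)
  then have "x = (T ^^ k) ((T ^^ a) y)"
    using L(4) by (simp add: funpow_plus add.commute)
  moreover have "(T ^^ a) y \<in> tower_set B n m s"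
    using L a by (auto simp: tower_set_def)
  ultimately show "x \<in> (\<Union>k<m. (T ^^ k) ` tower_set B n m s)"
    using a(2) by blast
qed

text \<open>A point on levels \<open>i < j\<close> would yield a return to \<open>B\<close> after
  \<open>j - i < n\<close> steps.\<close>

lemma separated_levels_disjoint:
  assumes "B \<subseteq> space M" "separated n B"
  shows "disjoint_family_on (\<lambda>j. (T ^^ j) ` B) {..<n}"
proof -
  have False if "i < j" "j < n" "y \<in> B" "y' \<in> B" "(T ^^ i) y = (T ^^ j) y'" for i j y y'
  proof -
    have "y = (T ^^ (j - i)) y'"
      using that assms(1) by (intro funpow_cancel) auto
    moreover have "1 \<le> j - i \<and> j - i < n"
      using that by auto
    ultimately show False
      using that(3,4) assms(2) unfolding separated_def by blast
  qed
  then show ?thesis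
    unfolding disjoint_family_on_def by (auto; metis linorder_neq_iff)
qed

end

section \<open>Choosing the position of the gap by averaging\<close>

lemma (in prob_space) sum_prob_le_one:
  assumes "finite I" "disjoint_family_on A I" "\<And>i. i \<in> I \<Longrightarrow> A i \<in> events"
  shows "(\<Sum>i\<in>I. prob (A i)) \<le> 1"
proof -
  have "(\<Sum>i\<in>I. prob (A i)) = prob (\<Union>i\<in>I. A i)"
    using assms by (intro finite_measure_finite_Union[symmetric]) auto
  then show ?thesis
    by simp
qed

theorem theorem2p7:
  fixes M :: "'a measure" and T :: "'a \<Rightarrow> 'a" and m p :: nat
    and \<mu> :: "nat \<Rightarrow> 'a measure" and \<epsilon> :: real
  assumes "m \<ge> 1"
    and "standard_borel_space M"
    and "borel_automorphism M T"
    and "aperiodic M T"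
    and "\<epsilon> > 0"
    and "\<And>i. i \<in> {1..p} \<Longrightarrow> prob_space (\<mu> i)"
    and "\<And>i. i \<in> {1..p} \<Longrightarrow> sets (\<mu> i) = sets M"
  shows "\<exists>F\<in>sets M. disjoint_family_on (\<lambda>k. (T ^^ k) ` F) {..<m} \<and>
           (\<forall>i\<in>{1..p}. measure (\<mu> i) (\<Union>k<m. (T ^^ k) ` F) > 1 - \<epsilon>)"
proof -
  interpret borel_aut M T
    by standard (rule assms(3))
  obtain K :: nat where K: "real p / \<epsilon> < real K"
    using reals_Archimedean2 by blast
  then have "K \<ge> 1"
    using assms(5) by (cases "K = 0") (auto simp: divide_less_0_iff)
  \<comment> \<open>This height leaves room for \<open>K\<close> disjoint strips of \<open>m\<close>
    levels, one for each candidate gap position.\<close>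
  define n where "n = K * m"
  have "n \<ge> 1"
    using \<open>K \<ge> 1\<close> assms(1) by (simp add: n_def)
  then obtain B where B: "B \<in> sets M" "separated n B" "space M \<subseteq> nbhd n B"
    using marker_exists[OF assms(2,4)] by blast
  have BX: "B \<subseteq> space M"
    using B(1) by (rule sets.sets_into_space)
  \<comment> \<open>Strip \<open>s\<close> contains every point missed by the blocks when the gap
    starts at level \<open>s * m\<close>.\<close>
  define E where "E s = (\<Union>j\<in>{s * m..<s * m + m}. (T ^^ j) ` B)" for s
  have E_sets: "E s \<in> sets M" for s
    unfolding E_def using B(1) by (intro sets.finite_UN funpow_image_sets) auto
  have block: "s * m + m \<le> t * m" if "s < t" for s t
    using mult_le_mono1[of "Suc s" t m] that by simp
  have disj: "disjoint_family_on E {..<K}"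
  proof -
    have "E s \<inter> E t = {}" if "s < t" "t < K" for s t
    proof -
      have "(T ^^ i) ` B \<inter> (T ^^ j) ` B = {}"
        if "i < s * m + m" "t * m \<le> j" "j < t * m + m" for i j
      proof -
        have "i < j" "j < n"
          using that block[OF \<open>s < t\<close>] block[OF \<open>t < K\<close>] unfolding n_def by linarith+
        then show ?thesis
          using separated_levels_disjoint[OF BX B(2)] unfolding disjoint_family_on_def by auto
      qed
      then show ?thesis
        unfolding E_def by fastforce
    qed
    then show ?thesis
      unfolding disjoint_family_on_def by (metis Int_commute lessThan_iff linorder_neq_iff)
  qed
  have sum_E: "(\<Sum>s<K. measure (\<mu> i) (E s)) \<le> 1" if "i \<in> {1..p}" for i
    using prob_space.sum_prob_le_one[OF assms(6)[OF that], of "{..<K}" E] disj E_sets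
      assms(7)[OF that] by simp
  \<comment> \<open>Otherwise summing over \<open>s\<close> and exchanging the sums gives
    \<open>K * \<epsilon> \<le> p\<close>, against the choice of \<open>K\<close>.\<close>
  have "\<exists>s<K. (\<Sum>i=1..p. measure (\<mu> i) (E s)) < \<epsilon>"
  proof (rule ccontr)
    assume "\<not> ?thesis"
    then have "(\<Sum>s<K. \<epsilon>) \<le> (\<Sum>s<K. \<Sum>i=1..p. measure (\<mu> i) (E s))"
      by (intro sum_mono) (meson lessThan_iff not_less)
    also have "\<dots> = (\<Sum>i=1..p. \<Sum>s<K. measure (\<mu> i) (E s))"
      by (rule sum.swap)
    also have "\<dots> \<le> (\<Sum>i=1..p. 1)"
      using sum_E by (intro sum_mono) auto
    finally show False
      using K assms(5) by (simp add: field_simps)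
  qed
  then obtain s where s: "s < K" "(\<Sum>i=1..p. measure (\<mu> i) (E s)) < \<epsilon>"
    by blast
  have sn: "s * m \<le> n"
    using s(1) by (simp add: n_def)
  define F where "F = tower_set B n m s"
  have F: "F \<in> sets M"
    unfolding F_def using B(1) by (rule tower_set_sets)
  have "measure (\<mu> i) (\<Union>k<m. (T ^^ k) ` F) > 1 - \<epsilon>" if i: "i \<in> {1..p}" for i
  proof -
    interpret prob_space "\<mu> i"
      using assms(6)[OF i] .
    have events: "events = sets M" "space (\<mu> i) = space M"
      using assms(7)[OF i] sets_eq_imp_space_eq by auto
    \<comment> \<open>Bounding the sum of the measures is what lets a single \<open>s\<close> serve
      all of them at once.\<close>
    have "measure (\<mu> i) (E s) \<le> (\<Sum>i=1..p. measure (\<mu> i) (E s))"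
      using i by (intro member_le_sum) auto
    then have "1 - \<epsilon> < 1 - prob (E s)"
      using s(2) by linarith
    also have "\<dots> = prob (space M - E s)"
      using prob_compl[of "E s"] E_sets events by simp
    also have "\<dots> \<le> prob (\<Union>k<m. (T ^^ k) ` F)"
    proof (rule finite_measure_mono)
      show "space M - E s \<subseteq> (\<Union>k<m. (T ^^ k) ` F)"
        unfolding E_def F_def using BX B assms(1) sn by (intro tower_set_cover) auto
      show "(\<Union>k<m. (T ^^ k) ` F) \<in> events"
        unfolding events using F by (intro sets.finite_UN funpow_image_sets) auto
    qed
    finally show ?thesis .
  qed
  moreover have "disjoint_family_on (\<lambda>k. (T ^^ k) ` F) {..<m}"
    unfolding F_def using BX sn by (rule tower_set_disjoint)
  ultimately show ?thesis
    using F by blast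
qed

end
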